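(* Let $X$ (treatment) and $Y$ (response) be random variables, let $x,x'$ be given values of $X$, and let $\mathbf{T}_1,\mathbf{T}_2$ be two sets of random variables. For $i=1,2$ let $\mathbf{T}^{m}_i\subset\mathbf{T}_i$ be a subset satisfying $X\perp\!\!\!\perp(\mathbf{T}_i\setminus\mathbf{T}^{m}_i)\mid\mathbf{T}^{m}_i$. If $\mathbf{T}^{m}_1=\mathbf{T}^{m}_2$, then $\mathbf{T}_1$ and $\mathbf{T}_2$ are weakly equivalent to each other (given $x$ and $x'$, relative to $(X,Y)$), i.e. for every value $y$ of $Y$, $$\sum_{\mathbf{t}_1}\operatorname{pr}(y\mid x,\mathbf{t}_1)\operatorname{pr}(\mathbf{t}_1\mid x')=\sum_{\mathbf{t}_2}\operatorname{pr}(y\mid x,\mathbf{t}_2)\operatorname{pr}(\mathbf{t}_2\mid x').$$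
   Context: All random variables $X$, $Y$ and those in $\mathbf{T}_1\cup\mathbf{T}_2$ are defined on a common probability space; $X,Y\notin \mathbf{T}_1\cup\mathbf{T}_2$. The variables are discrete (for continuous variables, sums are replaced by integrals). $\operatorname{pr}(\cdot)$ and $\operatorname{pr}(\cdot\mid\cdot)$ denote marginal and conditional probabilities, e.g. $\operatorname{pr}(y\mid x,\mathbf{t})=\operatorname{pr}(Y=y\mid X=x,\mathbf{T}=\mathbf{t})$. $\mathbf{A}\perp\!\!\!\perp\mathbf{B}\mid\mathbf{C}$ means $\mathbf{A}$ is conditionally independent of $\mathbf{B}$ given $\mathbf{C}$ (trivially true if $\mathbf{A}$ or $\mathbf{B}$ is empty; conditioning on the empty set means unconditional independence). Definition (weak equivalence, i.e. equivalence given $x$ and $x'$ relative to $(X,Y)$): $\mathbf{T}_1$ and $\mathbf{T}_2$ are weakly equivalent if, for every $y$, $\sum_{\mathbf{t}_1}\operatorname{pr}(y|x,\mathbf{t}_1)\operatorname{pr}(\mathbf{t}_1|x')=\sum_{\mathbf{t}_2}\operatorname{pr}(y|x,\mathbf{t}_2)\operatorname{pr}(\mathbf{t}_2|x')$, where the left-hand (respectively right-hand) side is replaced by $\operatorname{pr}(y|x)$ when $\mathbf{T}_1$ (respectively $\mathbf{T}_2$) is empty. Well-definedness: $\operatorname{pr}(x)>0$, $\operatorname{pr}(x')>0$, and for $i=1,2$, $\operatorname{pr}(x,\mathbf{t}_i)>0$ for every value $\mathbf{t}_i$ with $\operatorname{pr}(x',\mathbf{t}_i)>0$; the sums range over values $\mathbf{t}_i$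 with $\operatorname{pr}(\mathbf{t}_i\mid x')>0$. *)

theory Defs
  imports "HOL-Probability.Probability"
begin

text \<open>
  A system of random variables is a family V indexed by variable names; a set of random
  variables is a set of names. The set T is identified with its joint random vector, whose
  values are functions on names that are undefined off T. For empty T that vector is constant,
  so conditioning on it is the same as not conditioning. The common value type 'v is no
  restriction, since variables of different types embed into a sum type.
\<close>

definition joint :: "('i \<Rightarrow> 'a \<Rightarrow> 'v) \<Rightarrow> 'i set \<Rightarrow> 'a \<Rightarrow> ('i \<Rightarrow> 'v)" where
  "joint V T \<omega> = restrict (\<lambda>i. V i \<omega>) T"

definition discrete_rv :: "'a measure \<Rightarrow> ('a \<Rightarrow> 'b) \<Rightarrow> bool" where
  "discrete_rv M Z \<longleftrightarrow> Z \<in> measurable M (count_space UNIV) \<and> countable (Z ` space M)"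

definition cond_indep ::
  "'a measure \<Rightarrow> ('i \<Rightarrow> 'a \<Rightarrow> 'v) \<Rightarrow> 'i set \<Rightarrow> 'i set \<Rightarrow> 'i set \<Rightarrow> bool" where
  "cond_indep M V A B C \<longleftrightarrow>
     (\<forall>a b c. \<P>(\<omega> in M. joint V C \<omega> = c) > 0 \<longrightarrow>
        \<P>(\<omega> in M. joint V A \<omega> = a \<and> joint V B \<omega> = b \<bar> joint V C \<omega> = c) =
        \<P>(\<omega> in M. joint V A \<omega> = a \<bar> joint V C \<omega> = c) *
        \<P>(\<omega> in M. joint V B \<omega> = b \<bar> joint V C \<omega> = c))"

text \<open>
  The adjusted distribution of Y for the covariate set T. Its sum has nonnegative terms and total
  weight at most 1, so the infinite sum always converges.
\<close>

definition adjustment ::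
  "'a measure \<Rightarrow> ('i \<Rightarrow> 'a \<Rightarrow> 'v) \<Rightarrow> 'i \<Rightarrow> 'i \<Rightarrow> 'v \<Rightarrow> 'v \<Rightarrow> 'i set \<Rightarrow> 'v \<Rightarrow> real" where
  "adjustment M V X Y x x' T y =
     (if T = {} then \<P>(\<omega> in M. V Y \<omega> = y \<bar> V X \<omega> = x)
      else \<Sum>\<^sub>\<infinity>t\<in>{t. \<P>(\<omega> in M. joint V T \<omega> = t \<bar> V X \<omega> = x') > 0}.
        \<P>(\<omega> in M. V Y \<omega> = y \<bar> V X \<omega> = x \<and> joint V T \<omega> = t) *
        \<P>(\<omega> in M. joint V T \<omega> = t \<bar> V X \<omega> = x'))"

definition weakly_equivalent ::
  "'a measure \<Rightarrow> ('i \<Rightarrow> 'a \<Rightarrow> 'v) \<Rightarrow> 'i \<Rightarrow> 'i \<Rightarrow> 'v \<Rightarrow> 'v \<Rightarrow> 'i set \<Rightarrow> 'i set \<Rightarrow> bool" where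
  "weakly_equivalent M V X Y x x' T1 T2 \<longleftrightarrow>
     (\<forall>y. adjustment M V X Y x x' T1 y = adjustment M V X Y x x' T2 y)"

text \<open>A finite set of discrete variables is discrete as a vector.\<close>

lemma discrete_rv_joint:
  assumes fin: "finite T" and d: "\<And>i. i \<in> T \<Longrightarrow> discrete_rv M (V i)"
  shows "discrete_rv M (joint V T)"
proof -
  let ?S = "PiE T (\<lambda>i. V i ` space M)"
  have cS: "countable ?S"
    using fin d by (intro countable_PiE) (auto simp: discrete_rv_def)
  have img: "joint V T ` space M \<subseteq> ?S"
    by (auto simp: joint_def)
  have "joint V T \<in> measurable M (count_space ?S)"
    unfolding measurable_count_space_eq_countable[OF cS]
  proof (intro conjI ballI)
    show "joint V T \<in> space M \<rightarrow> ?S"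
      using img by auto
    fix t assume t: "t \<in> ?S"
    have "joint V T -` {t} \<inter> space M = {\<omega> \<in> space M. \<forall>i\<in>T. V i \<omega> = t i}"
      using t by (auto simp: joint_def fun_eq_iff PiE_iff extensional_def restrict_def)
    moreover have "{\<omega> \<in> space M. \<forall>i\<in>T. V i \<omega> = t i} \<in> sets M"
    proof (rule sets.sets_Collect_finite_All[OF _ fin])
      fix i assume "i \<in> T"
      then have "V i \<in> measurable M (count_space UNIV)"
        using d by (auto simp: discrete_rv_def)
      then have "V i -` {t i} \<inter> space M \<in> sets M"
        by (rule measurable_sets) simp
      moreover have "V i -` {t i} \<inter> space M = {\<omega> \<in> space M. V i \<omega> = t i}"
        by auto
      ultimately show "{\<omega> \<in> space M. V i \<omega> = t i} \<in> sets M" by simp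
    qed
    ultimately show "joint V T -` {t} \<inter> space M \<in> sets M" by simp
  qed
  then have "joint V T \<in> measurable M (count_space UNIV)"
    by (rule measurable_compose[where f = "joint V T" and g = "\<lambda>t. t", simplified]) simp
  moreover have "countable (joint V T ` space M)"
    using img cS by (rule countable_subset)
  ultimately show ?thesis
    by (simp add: discrete_rv_def)
qed

lemma joint_empty [simp]: "joint V {} = (\<lambda>_ _. undefined)"
  by (simp add: joint_def fun_eq_iff)

lemma (in prob_space) cond_indep_empty_cond:
  "cond_indep M V A B {} \<longleftrightarrow>
     (\<forall>a b. \<P>(\<omega> in M. joint V A \<omega> = a \<and> joint V B \<omega> = b) =
        \<P>(\<omega> in M. joint V A \<omega> = a) * \<P>(\<omega> in M. joint V B \<omega> = b))"
proof -
  have "\<P>(\<omega> in M. joint V {} \<omega> = c) = (if c = (\<lambda>_. undefined) then 1 else 0)" for c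
    by (cases "c = (\<lambda>_. undefined)") (auto simp: prob_space)
  then show ?thesis
    by (auto simp: cond_indep_def cond_prob_def prob_space split: if_splits)
qed

lemma (in prob_space) cond_indep_empty_left: "cond_indep M V {} B C"
  unfolding cond_indep_def
proof (intro allI impI)
  fix a b c
  assume "\<P>(\<omega> in M. joint V C \<omega> = c) > 0"
  then show "\<P>(\<omega> in M. joint V {} \<omega> = a \<and> joint V B \<omega> = b \<bar> joint V C \<omega> = c) =
        \<P>(\<omega> in M. joint V {} \<omega> = a \<bar> joint V C \<omega> = c) *
        \<P>(\<omega> in M. joint V B \<omega> = b \<bar> joint V C \<omega> = c)"
    by (cases "a = (\<lambda>_. undefined)") (auto simp: cond_prob_def)
qed

end

theory Submission
  imports Defs
begin

text \<open>
  For a covariate set T with X independent of T - S given S, the weight pr(t | x') / pr(x, t)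
  attached to pr(y, x, t) in the adjustment sum depends on t only through its restriction s to S:
  it equals pr(x', s) / (pr(x, s) pr(x')). The adjustment sum is therefore the
  expectation of that function of S over the event Y = y, X = x, in which T no longer occurs.
\<close>

text \<open>Nonnegative terms make unconditional and absolute summability the same, which links the
  two notions of infinite sum. The divergent case agrees by default values: both sums are then 0,
  and \<open>enn2real\<close> sends infinity to 0.\<close>

lemma infsum_eq_nn_integral_count_space:
  fixes f :: "'b \<Rightarrow> real"
  assumes "\<And>t. t \<in> A \<Longrightarrow> 0 \<le> f t"
  shows "infsum f A = enn2real (\<integral>\<^sup>+t. ennreal (f t) \<partial>count_space A)"
proof -
  have "infsum f A = infsetsum f A"
  proof (cases "Infinite_Set_Sum.abs_summable_on f A")
    case True
    then show ?thesis by (simp add: infsetsum_infsum)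
  next
    case False
    then have "\<not> f summable_on A"
      using assms abs_summable_equivalent[of f A] by (simp cong: summable_on_cong)
    then show ?thesis
      using False by (simp add: infsum_not_exists not_summable_infsetsum_eq)
  qed
  also have "\<dots> = enn2real (\<integral>\<^sup>+t. ennreal (f t) \<partial>count_space A)"
    unfolding infsetsum_def using assms by (intro integral_eq_nn_integral) (auto simp: AE_count_space)
  finally show ?thesis .
qed

text \<open>Each term is the integral of the constant \<open>g t\<close> over the event that
  \<open>P\<close> holds and \<open>Z\<close> equals \<open>t\<close>. After the sum and the
  integral are exchanged, only the index \<open>t = Z \<omega>\<close> survives at each \<omega>.
  This removes the summation over values of \<open>Z\<close>, so that sums indexed by different
  random vectors become comparable.\<close>

lemma (in finite_measure) infsum_discrete_rv:
  fixes g :: "'b \<Rightarrow> real"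
  assumes Z: "discrete_rv M Z" and E: "{\<omega> \<in> space M. P \<omega>} \<in> sets M" and g: "\<And>t. 0 \<le> g t"
  shows "(\<Sum>\<^sub>\<infinity>t. \<P>(\<omega> in M. P \<omega> \<and> Z \<omega> = t) * g t) =
    enn2real (\<integral>\<^sup>+\<omega>. ennreal (g (Z \<omega>)) * indicator {\<omega> \<in> space M. P \<omega>} \<omega> \<partial>M)"
proof -
  let ?R = "Z ` space M"
  let ?E = "\<lambda>t. {\<omega> \<in> space M. P \<omega> \<and> Z \<omega> = t}"
  have meas: "?E t \<in> sets M" for t
  proof -
    have "Z -` {t} \<inter> space M \<in> sets M"
      using Z by (intro measurable_sets[of Z M "count_space UNIV"]) (auto simp: discrete_rv_def)
    moreover have "?E t = {\<omega> \<in> space M. P \<omega>} \<inter> (Z -` {t} \<inter> space M)" by auto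
    ultimately show ?thesis using E by (metis sets.Int)
  qed
  \<comment> \<open>The exchange is made over a countable index set. The sum is therefore first cut
    down to the range of \<open>Z\<close>; outside it the events are empty.\<close>
  have cR: "countable ?R" using Z by (simp add: discrete_rv_def)
  have "(\<Sum>\<^sub>\<infinity>t. \<P>(\<omega> in M. P \<omega> \<and> Z \<omega> = t) * g t) =
      (\<Sum>\<^sub>\<infinity>t\<in>?R. measure M (?E t) * g t)"
  proof (rule infsum_cong_neutral)
    fix t assume "t \<in> UNIV - ?R"
    then have "?E t = {}" by auto
    then show "measure M (?E t) * g t = 0" by (metis measure_empty mult_zero_left)
  qed auto
  also have "\<dots> = enn2real (\<integral>\<^sup>+t. ennreal (measure M (?E t) * g t) \<partial>count_space ?R)"
    using g by (intro infsum_eq_nn_integral_count_space) simp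
  also have "(\<integral>\<^sup>+t. ennreal (measure M (?E t) * g t) \<partial>count_space ?R) =
      (\<integral>\<^sup>+t. (\<integral>\<^sup>+\<omega>. ennreal (g t) * indicator (?E t) \<omega> \<partial>M) \<partial>count_space ?R)"
    using meas g
    by (intro nn_integral_cong)
      (simp add: nn_integral_cmult_indicator emeasure_eq_measure ennreal_mult mult.commute)
  also have "\<dots> = (\<integral>\<^sup>+\<omega>. (\<integral>\<^sup>+t. ennreal (g t) * indicator (?E t) \<omega> \<partial>count_space ?R) \<partial>M)"
    using meas cR by (intro nn_integral_count_space_nn_integral[symmetric]) auto
  also have "\<dots> = (\<integral>\<^sup>+\<omega>. ennreal (g (Z \<omega>)) * indicator {\<omega> \<in> space M. P \<omega>} \<omega> \<partial>M)"
  proof (rule nn_integral_cong)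
    fix \<omega> assume \<omega>: "\<omega> \<in> space M"
    have "(\<integral>\<^sup>+t. ennreal (g t) * indicator (?E t) \<omega> \<partial>count_space ?R) =
        (\<integral>\<^sup>+t. ennreal (g t) * indicator {\<omega> \<in> space M. P \<omega>} \<omega> * indicator {Z \<omega>} t \<partial>count_space ?R)"
      by (intro nn_integral_cong) (auto simp: indicator_def)
    also have "\<dots> = ennreal (g (Z \<omega>)) * indicator {\<omega> \<in> space M. P \<omega>} \<omega>"
      using \<omega> by (subst nn_integral_indicator_singleton) auto
    finally show "(\<integral>\<^sup>+t. ennreal (g t) * indicator (?E t) \<omega> \<partial>count_space ?R) =
        ennreal (g (Z \<omega>)) * indicator {\<omega> \<in> space M. P \<omega>} \<omega>" .
  qed
  finally show ?thesis .
qed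

lemma joint_subset: "S \<subseteq> T \<Longrightarrow> joint V S \<omega> = restrict (joint V T \<omega>) S"
  by (auto simp: joint_def fun_eq_iff restrict_def)

text \<open>Extensionality matters because \<open>joint V T\<close> is undefined off
  \<open>T\<close>: the two restrictions fix \<open>t\<close> on \<open>T\<close>, and only the
  common default fixes it elsewhere. The right-hand side is the shape of event that
  \<open>cond_indep\<close> speaks about.\<close>

lemma joint_eq_iff_split:
  assumes "S \<subseteq> T" "t \<in> extensional T"
  shows "joint V T \<omega> = t \<longleftrightarrow>
    joint V (T - S) \<omega> = restrict t (T - S) \<and> joint V S \<omega> = restrict t S"
proof
  assume "joint V T \<omega> = t"
  then show "joint V (T - S) \<omega> = restrict t (T - S) \<and> joint V S \<omega> = restrict t S"
    using joint_subset[of S T V \<omega>] joint_subset[of "T - S" T V \<omega>] assms(1) by auto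
next
  assume R: "joint V (T - S) \<omega> = restrict t (T - S) \<and> joint V S \<omega> = restrict t S"
  show "joint V T \<omega> = t"
  proof (rule extensionalityI[of _ T])
    show "joint V T \<omega> \<in> extensional T" by (simp add: joint_def)
    fix i assume i: "i \<in> T"
    show "joint V T \<omega> i = t i"
    proof (cases "i \<in> S")
      case True
      then have "joint V S \<omega> i = t i" using R by simp
      then show ?thesis using True i by (simp add: joint_def)
    next
      case False
      then have "joint V (T - S) \<omega> i = t i" using R i by simp
      then show ?thesis using False i by (simp add: joint_def)
    qed
  qed (use assms in auto)
qed

text \<open>\<open>cond_indep\<close> takes sets of names, so the single variable \<open>X\<close>
  enters it as a vector over \<open>{X}\<close>. This translates back to plain values of
  \<open>X\<close>.\<close>

lemma joint_singleton_eq_iff: "joint V {X} \<omega> = restrict (\<lambda>_. a) {X} \<longleftrightarrow> V X \<omega> = a"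
  by (auto simp: joint_def fun_eq_iff restrict_def)

lemma sets_discrete_rv_Collect:
  assumes "discrete_rv M Z"
  shows "{\<omega> \<in> space M. Q (Z \<omega>)} \<in> sets M"
proof -
  have "Z -` Collect Q \<inter> space M \<in> sets M"
    using assms by (intro measurable_sets[of Z M "count_space UNIV"]) (auto simp: discrete_rv_def)
  also have "Z -` Collect Q \<inter> space M = {\<omega> \<in> space M. Q (Z \<omega>)}" by auto
  finally show ?thesis .
qed

text \<open>This is pr(a | t) = pr(a | s), for s the restriction of t to \<open>S\<close>, cleared
  of denominators. When pr(s) > 0 it is the independence statement multiplied by pr(s) squared. When
  pr(s) = 0 the left side vanishes, and so does the right one, since pr(a, s) is at most
  pr(s).\<close>

lemma (in prob_space) cond_indep_prob_joint:
  assumes ci: "cond_indep M V {X} (T - S) S" and S: "S \<subseteq> T" and t: "t \<in> extensional T"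
    and dX: "discrete_rv M (V X)" and dT: "discrete_rv M (joint V T)"
  shows "\<P>(\<omega> in M. V X \<omega> = a \<and> joint V T \<omega> = t) * \<P>(\<omega> in M. joint V S \<omega> = restrict t S) =
    \<P>(\<omega> in M. V X \<omega> = a \<and> joint V S \<omega> = restrict t S) * \<P>(\<omega> in M. joint V T \<omega> = t)"
proof (cases "\<P>(\<omega> in M. joint V S \<omega> = restrict t S) > 0")
  case True
  let ?s = "restrict t S" and ?p = "\<P>(\<omega> in M. joint V S \<omega> = restrict t S)"
  from ci True have
    "\<P>(\<omega> in M. joint V {X} \<omega> = restrict (\<lambda>_. a) {X} \<and>
        joint V (T - S) \<omega> = restrict t (T - S) \<bar> joint V S \<omega> = ?s) =
     \<P>(\<omega> in M. joint V {X} \<omega> = restrict (\<lambda>_. a) {X} \<bar> joint V S \<omega> = ?s) *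
     \<P>(\<omega> in M. joint V (T - S) \<omega> = restrict t (T - S) \<bar> joint V S \<omega> = ?s)"
    unfolding cond_indep_def by blast
  then have "\<P>(\<omega> in M. V X \<omega> = a \<and> joint V T \<omega> = t) / ?p =
     \<P>(\<omega> in M. V X \<omega> = a \<and> joint V S \<omega> = ?s) / ?p * (\<P>(\<omega> in M. joint V T \<omega> = t) / ?p)"
    unfolding cond_prob_def joint_singleton_eq_iff joint_eq_iff_split[OF S t] conj_assoc .
  then show ?thesis using True by (simp add: field_simps)
next
  case False
  have m: "{\<omega> \<in> space M. joint V S \<omega> = restrict t S} \<in> sets M"
    using sets_discrete_rv_Collect[OF dT, of "\<lambda>u. restrict u S = restrict t S"]
    by (simp add: joint_subset[OF S])
  have "\<P>(\<omega> in M. V X \<omega> = a \<and> joint V S \<omega> = restrict t S)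
      \<le> \<P>(\<omega> in M. joint V S \<omega> = restrict t S)"
    using m by (intro finite_measure_mono) auto
  moreover have "\<P>(\<omega> in M. joint V S \<omega> = restrict t S) = 0"
    using False by (simp only: zero_less_measure_iff not_not)
  ultimately show ?thesis by (simp only: measure_le_0_iff mult_zero_left mult_zero_right)
qed

lemma (in prob_space) adjustment_eq_nn_integral:
  assumes dX: "discrete_rv M (V X)" and dY: "discrete_rv M (V Y)"
    and dT: "discrete_rv M (joint V T)"
    and px': "\<P>(\<omega> in M. V X \<omega> = x') > 0"
    and pos: "\<And>t. \<P>(\<omega> in M. V X \<omega> = x' \<and> joint V T \<omega> = t) > 0 \<Longrightarrow>
           \<P>(\<omega> in M. V X \<omega> = x \<and> joint V T \<omega> = t) > 0"
    and S: "S \<subseteq> T" and ci: "cond_indep M V {X} (T - S) S"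
  defines "r \<equiv> \<lambda>s. \<P>(\<omega> in M. V X \<omega> = x' \<and> joint V S \<omega> = s) /
      (\<P>(\<omega> in M. V X \<omega> = x \<and> joint V S \<omega> = s) * \<P>(\<omega> in M. V X \<omega> = x'))"
  shows "adjustment M V X Y x x' T y =
    enn2real (\<integral>\<^sup>+\<omega>. ennreal (r (joint V S \<omega>)) *
      indicator {\<omega> \<in> space M. V Y \<omega> = y \<and> V X \<omega> = x} \<omega> \<partial>M)"
proof -
  let ?E = "{\<omega> \<in> space M. V Y \<omega> = y \<and> V X \<omega> = x}"
  have mX: "{\<omega> \<in> space M. V X \<omega> = a} \<in> sets M" for a
    by (rule sets_discrete_rv_Collect[OF dX])
  have mY: "{\<omega> \<in> space M. V Y \<omega> = y} \<in> sets M"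
    by (rule sets_discrete_rv_Collect[OF dY])
  have mT: "{\<omega> \<in> space M. joint V T \<omega> = t} \<in> sets M" for t
    by (rule sets_discrete_rv_Collect[OF dT])
  have mXT: "{\<omega> \<in> space M. V X \<omega> = a \<and> joint V T \<omega> = t} \<in> sets M" for a t
    by (rule sets.sets_Collect_conj[OF mT mX])
  have mE: "?E \<in> sets M"
    by (rule sets.sets_Collect_conj[OF mX mY])
  have mS: "{\<omega> \<in> space M. joint V S \<omega> = s} \<in> sets M" for s
    using sets_discrete_rv_Collect[OF dT, of "\<lambda>u. restrict u S = s"]
    by (simp add: joint_subset[OF S])
  have mXS: "{\<omega> \<in> space M. V X \<omega> = a \<and> joint V S \<omega> = s} \<in> sets M" for a s
    by (rule sets.sets_Collect_conj[OF mS mX])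
  have r: "0 \<le> r s" for s by (simp add: r_def)
  show ?thesis
  proof (cases "T = {}")
    \<comment> \<open>Here \<open>joint V S\<close> is constant and pr(x') cancels in
      \<open>r\<close>, so the weight is 1 / pr(x) and the integral is pr(y | x), the separate value
      of \<open>adjustment\<close> for the empty set.\<close>
    case True
    then have "S = {}" using S by simp
    then have "(\<integral>\<^sup>+\<omega>. ennreal (r (joint V S \<omega>)) * indicator ?E \<omega> \<partial>M) =
        ennreal (r (\<lambda>_. undefined) * prob ?E)"
      using mE r by (simp add: nn_integral_cmult_indicator emeasure_eq_measure ennreal_mult)
    moreover have "r (\<lambda>_. undefined) = 1 / \<P>(\<omega> in M. V X \<omega> = x)"
      using \<open>S = {}\<close> px' by (simp add: r_def)
    ultimately show ?thesis
      using True by (simp add: adjustment_def cond_prob_def)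
  next
    case False
    have term_eq: "\<P>(\<omega> in M. V Y \<omega> = y \<bar> V X \<omega> = x \<and> joint V T \<omega> = t) *
          \<P>(\<omega> in M. joint V T \<omega> = t \<bar> V X \<omega> = x') =
        \<P>(\<omega> in M. (V Y \<omega> = y \<and> V X \<omega> = x) \<and> joint V T \<omega> = t) * r (restrict t S)"
      if ppos: "\<P>(\<omega> in M. joint V T \<omega> = t \<bar> V X \<omega> = x') > 0" for t
    proof -
      let ?s = "restrict t S"
      let ?A = "\<P>(\<omega> in M. V X \<omega> = x \<and> joint V T \<omega> = t)"
      let ?A' = "\<P>(\<omega> in M. V X \<omega> = x' \<and> joint V T \<omega> = t)"
      let ?B = "\<P>(\<omega> in M. V X \<omega> = x \<and> joint V S \<omega> = ?s)"
      let ?B' = "\<P>(\<omega> in M. V X \<omega> = x' \<and> joint V S \<omega> = ?s)"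
      let ?p = "\<P>(\<omega> in M. joint V S \<omega> = ?s)"
      let ?q = "\<P>(\<omega> in M. joint V T \<omega> = t)"
      have A': "?A' > 0"
        using ppos px' by (simp add: cond_prob_def zero_less_divide_iff conj_commute)
      then have A: "?A > 0" by (rule pos)
      \<comment> \<open>A value that is not extensional is never taken by \<open>joint V T\<close>,
        against pr(x, t) > 0.\<close>
      have t: "t \<in> extensional T"
      proof (rule ccontr)
        assume "t \<notin> extensional T"
        then have "{\<omega> \<in> space M. V X \<omega> = x \<and> joint V T \<omega> = t} = {}"
          by (auto simp: joint_def)
        with A show False by simp
      qed
      have "?A \<le> ?B" "?B \<le> ?p" "?A \<le> ?q"
        using mXT mXS mT mS by (intro finite_measure_mono; auto simp: joint_subset[OF S])+
      then have "?p > 0" "?q > 0" using A by linarith+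
      moreover have "?A * ?p = ?B * ?q" "?A' * ?p = ?B' * ?q"
        by (rule cond_indep_prob_joint[OF ci S t dX dT])+
      \<comment> \<open>For both treatment values, pr(., t) is pr(., s) scaled by the same factor
        pr(t) / pr(s), namely \<open>q / p\<close>, which cancels in the quotient.\<close>
      moreover have ratio: "b' / (b * d) = a' / d / a"
        if "a * p = b * q" "a' * p = b' * q" "0 < p" "0 < q" for a a' b b' p q d :: real
      proof -
        have "a = b * (q / p)" "a' = b' * (q / p)" using that by (auto simp: field_simps)
        then show ?thesis using that by simp
      qed
      ultimately have "r ?s = ?A' / \<P>(\<omega> in M. V X \<omega> = x') / ?A"
        unfolding r_def by (intro ratio)
      moreover have "\<P>(\<omega> in M. V Y \<omega> = y \<bar> V X \<omega> = x \<and> joint V T \<omega> = t) =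
          \<P>(\<omega> in M. (V Y \<omega> = y \<and> V X \<omega> = x) \<and> joint V T \<omega> = t) / ?A"
        by (simp add: cond_prob_def conj_assoc)
      moreover have "\<P>(\<omega> in M. joint V T \<omega> = t \<bar> V X \<omega> = x') = ?A' / \<P>(\<omega> in M. V X \<omega> = x')"
        by (simp add: cond_prob_def conj_commute)
      ultimately show ?thesis
        by (simp only: times_divide_eq_left times_divide_eq_right divide_divide_eq_left mult_ac)
    qed
    \<comment> \<open>The adjustment sum runs only over t with pr(t | x') > 0, whereas
      \<open>infsum_discrete_rv\<close> sums over all t. For an excluded t, pr(x', t) = 0, so the
      product identity forces pr(x', s) = 0 or pr(t) = 0. In the first case the weight vanishes, in
      the second the probability it multiplies.\<close>
    have term_zero: "\<P>(\<omega> in M. (V Y \<omega> = y \<and> V X \<omega> = x) \<and> joint V T \<omega> = t) * r (restrict t S) = 0"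
      if np: "\<not> \<P>(\<omega> in M. joint V T \<omega> = t \<bar> V X \<omega> = x') > 0" for t
    proof (cases "t \<in> extensional T")
      case False
      then have "{\<omega> \<in> space M. (V Y \<omega> = y \<and> V X \<omega> = x) \<and> joint V T \<omega> = t} = {}"
        by (auto simp: joint_def)
      then show ?thesis by (simp only: measure_empty mult_zero_left)
    next
      case t: True
      have "\<P>(\<omega> in M. V X \<omega> = x' \<and> joint V T \<omega> = t) = 0"
        using np px' by (simp add: cond_prob_def zero_less_divide_iff conj_commute zero_less_measure_iff)
      then have "\<P>(\<omega> in M. V X \<omega> = x' \<and> joint V S \<omega> = restrict t S) = 0 \<or>
          \<P>(\<omega> in M. joint V T \<omega> = t) = 0"
        using cond_indep_prob_joint[OF ci S t dX dT, of x'] by simp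
      moreover have "\<P>(\<omega> in M. (V Y \<omega> = y \<and> V X \<omega> = x) \<and> joint V T \<omega> = t)
          \<le> \<P>(\<omega> in M. joint V T \<omega> = t)"
        using mT by (intro finite_measure_mono) auto
      ultimately have "r (restrict t S) = 0 \<or>
          \<P>(\<omega> in M. (V Y \<omega> = y \<and> V X \<omega> = x) \<and> joint V T \<omega> = t) \<le> 0"
        unfolding r_def by (elim disjE) simp_all
      then show ?thesis
        by (simp only: measure_le_0_iff mult_eq_0_iff disj_commute)
    qed
    have "adjustment M V X Y x x' T y =
        (\<Sum>\<^sub>\<infinity>t. \<P>(\<omega> in M. (V Y \<omega> = y \<and> V X \<omega> = x) \<and> joint V T \<omega> = t) * r (restrict t S))"
      unfolding adjustment_def if_not_P[OF False]
      by (rule infsum_cong_neutral) (simp_all only: term_eq term_zero mem_Collect_eq Diff_iff Int_iff UNIV_I simp_thms)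
    also have "\<dots> = enn2real (\<integral>\<^sup>+\<omega>. ennreal (r (restrict (joint V T \<omega>) S)) * indicator ?E \<omega> \<partial>M)"
      using dT mE r by (intro infsum_discrete_rv) auto
    finally show ?thesis by (simp add: joint_subset[OF S])
  qed
qed

theorem theorem2:
  fixes M :: "'a measure" and V :: "'i \<Rightarrow> 'a \<Rightarrow> 'v"
    and X Y :: 'i and x x' :: 'v and T1 T2 Tm1 Tm2 :: "'i set"
  assumes "prob_space M"
    and "X \<notin> T1 \<union> T2" and "Y \<notin> T1 \<union> T2"
    and "discrete_rv M (V X)" and "discrete_rv M (V Y)"
    and "discrete_rv M (joint V T1)" and "discrete_rv M (joint V T2)"
    and "\<P>(\<omega> in M. V X \<omega> = x) > 0" and "\<P>(\<omega> in M. V X \<omega> = x') > 0"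
    and "\<And>t. \<P>(\<omega> in M. V X \<omega> = x' \<and> joint V T1 \<omega> = t) > 0 \<Longrightarrow>
           \<P>(\<omega> in M. V X \<omega> = x \<and> joint V T1 \<omega> = t) > 0"
    and "\<And>t. \<P>(\<omega> in M. V X \<omega> = x' \<and> joint V T2 \<omega> = t) > 0 \<Longrightarrow>
           \<P>(\<omega> in M. V X \<omega> = x \<and> joint V T2 \<omega> = t) > 0"
    and "Tm1 \<subseteq> T1" and "cond_indep M V {X} (T1 - Tm1) Tm1"
    and "Tm2 \<subseteq> T2" and "cond_indep M V {X} (T2 - Tm2) Tm2"
    and "Tm1 = Tm2"
  shows "weakly_equivalent M V X Y x x' T1 T2"
proof -
  interpret prob_space M by fact
  show ?thesis
    unfolding weakly_equivalent_def
  proof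
    fix y
    \<comment> \<open>Each covariate set is evaluated with its own subset \<open>Tm1\<close> or
      \<open>Tm2\<close>. Once these are identified, the two integrals are literally the
      same.\<close>
    note eq = adjustment_eq_nn_integral[OF assms(4,5) _ assms(9)]
    show "adjustment M V X Y x x' T1 y = adjustment M V X Y x x' T2 y"
      using eq[OF assms(6) assms(10) assms(12,13)] eq[OF assms(7) assms(11) assms(14,15)]
      unfolding assms(16) by (rule trans[OF _ sym])
  qed
qed

end
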